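(* Let $R$ be a ring with $1\neq 0$, let $\Lambda$ be a set, and let $\Delta\subseteq\Lambda\times\Lambda$ satisfy axioms (A1) and (A2). Let $\prec$ be any strict total order on $\Delta$. Then $G(\Delta)$ is equal to the product, in increasing $\prec$-order, of its subgroups $X_{i,j}$, $(i,j)\in\Delta$, with uniqueness of expression. That is, for every $g\in G(\Delta)$ there is a unique family $(a_{\alpha})_{\alpha\in\Delta}$ of elements of $R$ with finite support such that $g=x_{\alpha_1}(a_{\alpha_1})\cdots x_{\alpha_m}(a_{\alpha_m})$, where $\alpha_1\prec\cdots\prec\alpha_m$ are the elements of the support (the empty product being $1$).
   Context: Rings are associative and unital, not necessarily commutative. For a subset $\Delta\subseteq\Lambda\times\Lambda$ the axioms are: (A1) $(i,i)\notin\Delta$ for all $i\in\Lambda$; (A2) whenever $(i,j),(j,k),(k,\ell),(i,\ell)\in\Delta$, one has $(i,k)\in\Delta\Leftrightarrow(j,\ell)\in\Delta$. $R\Delta$ is the free $R$-module with basis $\{e_{i,j} : (i,j)\in\Delta\}$, made into a (nonunital) ring by $(ae_{i,j})(be_{k,\ell})=ab\,e_{i,\ell}$ if $j=k$ and $(i,\ell)\in\Delta$, and $(ae_{i,j})(be_{k,\ell})=0$ otherwise. Adjoining $1$ gives the ring $R\cdot 1\oplus R\Delta$ (scalars from $R$ commute with the basis elements, i.e. $e_{i,j}\cdot r=r e_{i,j}$), and $G(\Delta)=\{1+x : x\in R\Delta\}$, a subgroup of its unit group. For $\alpha=(i,j)\in\Delta$ and $a\in R$, $x_{\alpha}(a)=x_{i,j}(a)=1+ae_{i,j}$,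 and $X_{i,j}=\{x_{i,j}(a) : a\in R\}$, a subgroup of $G(\Delta)$. *)

theory Defs
  imports "HOL-Library.Poly_Mapping" "HOL-Algebra.Ring"
begin

text \<open>
  The coefficient ring is a type of class \<open>ring_1\<close> (so \<open>1 \<noteq> 0\<close>, not necessarily commutative).
  An element of the free module \<open>R\<Delta>\<close> is a finitely supported function on pairs whose support
  lies in \<open>\<Delta>\<close>; the basis vector \<open>e\<^sub>i\<^sub>,\<^sub>j\<close> with coefficient \<open>a\<close> is \<open>Poly_Mapping.single (i, j) a\<close>.
\<close>

type_synonym ('i, 'a) fmod = "('i \<times> 'i) \<Rightarrow>\<^sub>0 'a"

definition free_mod :: "('i \<times> 'i) set \<Rightarrow> ('i, 'a::ring_1) fmod set"
  where "free_mod \<Delta> = {x. Poly_Mapping.keys x \<subseteq> \<Delta>}"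

definition basis_mult ::
    "('i \<times> 'i) set \<Rightarrow> 'i \<times> 'i \<Rightarrow> 'a::ring_1 \<Rightarrow> 'i \<times> 'i \<Rightarrow> 'a \<Rightarrow> ('i, 'a) fmod"
  where "basis_mult \<Delta> \<alpha> a \<beta> b =
    (if snd \<alpha> = fst \<beta> \<and> (fst \<alpha>, snd \<beta>) \<in> \<Delta>
     then Poly_Mapping.single (fst \<alpha>, snd \<beta>) (a * b) else 0)"

text \<open>The biadditive extension of \<^const>\<open>basis_mult\<close>.\<close>

definition free_mult ::
    "('i \<times> 'i) set \<Rightarrow> ('i, 'a::ring_1) fmod \<Rightarrow> ('i, 'a) fmod \<Rightarrow> ('i, 'a) fmod"
  where "free_mult \<Delta> x y =
    (\<Sum>\<alpha>\<in>Poly_Mapping.keys x. \<Sum>\<beta>\<in>Poly_Mapping.keys y.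
       basis_mult \<Delta> \<alpha> (Poly_Mapping.lookup x \<alpha>) \<beta> (Poly_Mapping.lookup y \<beta>))"

lemma free_mult_single:
  "free_mult \<Delta> (Poly_Mapping.single (i, j) a) (Poly_Mapping.single (k, l) b) =
    (if j = k \<and> (i, l) \<in> \<Delta> then Poly_Mapping.single (i, l) (a * b) else 0)"
  by (auto simp: free_mult_def basis_mult_def)

text \<open>
  The ring \<open>R \<cdot> 1 \<oplus> R\<Delta>\<close>: the pair \<open>(r, x)\<close> stands for \<open>r \<cdot> 1 + x\<close>. In \<open>x s\<close> the scalar acts on
  the coefficients from the right, because scalars commute with the basis elements.
\<close>

definition adj_ring :: "('i \<times> 'i) set \<Rightarrow> ('a::ring_1 \<times> ('i, 'a) fmod) ring"
  where "adj_ring \<Delta> =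
    \<lparr>carrier = UNIV \<times> free_mod \<Delta>,
     mult = (\<lambda>(r, x) (s, y).
       (r * s, Poly_Mapping.map (\<lambda>c. r * c) y + Poly_Mapping.map (\<lambda>c. c * s) x + free_mult \<Delta> x y)),
     one = (1, 0),
     zero = (0, 0),
     add = (\<lambda>(r, x) (s, y). (r + s, x + y))\<rparr>"

definition G :: "('i \<times> 'i) set \<Rightarrow> ('a::ring_1 \<times> ('i, 'a) fmod) set"
  where "G \<Delta> = {\<one>\<^bsub>adj_ring \<Delta>\<^esub> \<oplus>\<^bsub>adj_ring \<Delta>\<^esub> (0, x) | x. x \<in> free_mod \<Delta>}"

definition root_elt :: "('i \<times> 'i) set \<Rightarrow> 'i \<times> 'i \<Rightarrow> 'a::ring_1 \<Rightarrow> 'a \<times> ('i, 'a) fmod"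
  where "root_elt \<Delta> \<alpha> a = \<one>\<^bsub>adj_ring \<Delta>\<^esub> \<oplus>\<^bsub>adj_ring \<Delta>\<^esub> (0, Poly_Mapping.single \<alpha> a)"

definition root_subgroup :: "('i \<times> 'i) set \<Rightarrow> 'i \<times> 'i \<Rightarrow> ('a::ring_1 \<times> ('i, 'a) fmod) set"
  where "root_subgroup \<Delta> \<alpha> = range (root_elt \<Delta> \<alpha>)"

definition list_prod ::
    "('i \<times> 'i) set \<Rightarrow> ('a::ring_1 \<times> ('i, 'a) fmod) list \<Rightarrow> 'a \<times> ('i, 'a) fmod"
  where "list_prod \<Delta> gs = foldr (\<lambda>g h. g \<otimes>\<^bsub>adj_ring \<Delta>\<^esub> h) gs \<one>\<^bsub>adj_ring \<Delta>\<^esub>"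

text \<open>
  The product, in increasing order, of the subgroups indexed by \<open>\<Delta>\<close>: all finite products
  \<open>g\<^sub>1 \<cdots> g\<^sub>m\<close> with \<open>g\<^sub>k\<close> in the subgroup of \<open>\<alpha>\<^sub>k\<close> and \<open>\<alpha>\<^sub>1 \<prec> \<cdots> \<prec> \<alpha>\<^sub>m\<close> in \<open>\<Delta>\<close>.
\<close>

definition ordered_product ::
    "('i \<times> 'i) set \<Rightarrow> ('i \<times> 'i \<Rightarrow> 'i \<times> 'i \<Rightarrow> bool) \<Rightarrow> ('a::ring_1 \<times> ('i, 'a) fmod) set"
  where "ordered_product \<Delta> prec =
    {list_prod \<Delta> gs | \<alpha>s gs. set \<alpha>s \<subseteq> \<Delta> \<and> sorted_wrt prec \<alpha>s \<and>
       list_all2 (\<lambda>\<alpha> g. g \<in> root_subgroup \<Delta> \<alpha>) \<alpha>s gs}"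

end

theory Submission
  imports Defs
begin

text \<open>
  Order the roots in a finite part of \<open>\<Delta>\<close> by the length of the longest chain
  \<open>i = i\<^sub>0, \<dots>, i\<^sub>n = k\<close> all of whose pairs \<open>(i\<^sub>p, i\<^sub>q)\<close>, \<open>p < q\<close>, lie in \<open>\<Delta>\<close>. By (A1) such
  a chain has no repetitions, so the length is bounded, and by (A2) it strictly increases from
  \<open>(i, j)\<close> and from \<open>(j, k)\<close> to \<open>(i, k)\<close>. Expanding an ordered product of root elements, the
  coefficient at \<open>\<beta>\<close> is \<open>a\<^sub>\<beta>\<close> plus a term that involves only coefficients \<open>a\<^sub>\<alpha>\<close> at roots of
  smaller rank. This triangular system has exactly one solution.
\<close>

section \<open>Sorted enumerations of finite sets\<close>

lemma sorted_wrt_distinct: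
  assumes "sorted_wrt R xs" "irreflp_on (set xs) R"
  shows "distinct xs"
  using assms by (induction xs) (auto simp: irreflp_on_def)

text \<open>Insertion: the new element goes after everything related to it and before the rest. The
  hypotheses are relative to \<open>S\<close> because \<prec> is an order on \<Delta> only, not on
  the whole type.\<close>

lemma sorted_wrt_list_exists:
  assumes "finite S" "transp_on S R" "totalp_on S R"
  shows "\<exists>xs. sorted_wrt R xs \<and> set xs = S"
  using assms
proof (induction S rule: finite_induct)
  case (insert x S)
  have "transp_on S R" "totalp_on S R"
    using insert.prems by (auto intro: transp_on_subset totalp_on_subset)
  then obtain xs where xs: "sorted_wrt R xs" "set xs = S"
    using insert.IH by blast
  let ?ys = "filter (\<lambda>y. R y x) xs @ x # filter (\<lambda>y. \<not> R y x) xs"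
  have total: "R x y" if "y \<in> S" "\<not> R y x" for y
    using that insert.hyps(2) insert.prems(2) unfolding totalp_on_def by auto
  have trans: "R y z" if "R y x" "R x z" "y \<in> S" "z \<in> S" for y z
    using that insert.prems(1) unfolding transp_on_def by blast
  have "sorted_wrt R ?ys"
    using xs total trans by (auto simp: sorted_wrt_append sorted_wrt_filter)
  moreover have "set ?ys = insert x S"
    using xs by auto
  ultimately show ?case by blast
qed simp

text \<open>Each head is a least element of the common set, so the heads coincide, as irreflexivity
  and transitivity exclude 2-cycles. Distinctness then makes the sets of the tails agree.\<close>

lemma sorted_wrt_list_unique:
  assumes "sorted_wrt R xs" "sorted_wrt R ys" "set xs = set ys"
    and "irreflp_on (set xs) R" "transp_on (set xs) R"
  shows "xs = ys"
  using assms
proof (induction xs arbitrary: ys)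
  case (Cons x xs)
  then obtain y ys' where ys: "ys = y # ys'"
    by (cases ys) auto
  have nocycle: "\<not> (R u v \<and> R v u)" if "u \<in> set (x # xs)" "v \<in> set (x # xs)" for u v
    using that Cons.prems(4,5) unfolding irreflp_on_def transp_on_def by blast
  have "x = y \<or> R y x" "x = y \<or> R x y" "y \<in> set (x # xs)"
    using Cons.prems(1-3) ys by auto
  then have "x = y"
    using nocycle[of x y] by auto
  moreover have "distinct (x # xs)" "distinct ys"
    using Cons.prems by (auto intro!: sorted_wrt_distinct simp del: distinct.simps)
  then have "set xs = set ys'"
    using Cons.prems(3) ys \<open>x = y\<close> by auto
  then have "xs = ys'"
    using Cons.IH[of ys'] Cons.prems ys
    by (auto intro: irreflp_on_subset transp_on_subset)
  ultimately show ?case using ys by simp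
qed simp

section \<open>A rank function from chains\<close>

lemma ordered_pairs_rank:
  fixes \<Delta> :: "('i \<times> 'i) set"
  assumes fin: "finite V"
    and A1: "\<And>i. (i, i) \<notin> \<Delta>"
    and A2: "\<And>i j k l. (i, j) \<in> \<Delta> \<Longrightarrow> (j, k) \<in> \<Delta> \<Longrightarrow> (k, l) \<in> \<Delta> \<Longrightarrow> (i, l) \<in> \<Delta> \<Longrightarrow>
               ((i, k) \<in> \<Delta> \<longleftrightarrow> (j, l) \<in> \<Delta>)"
  obtains h :: "'i \<times> 'i \<Rightarrow> nat" where
    "\<And>i j k. (i, j) \<in> \<Delta> \<inter> V \<times> V \<Longrightarrow> (j, k) \<in> \<Delta> \<inter> V \<times> V \<Longrightarrow> (i, k) \<in> \<Delta> \<Longrightarrow>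
       h (i, j) < h (i, k) \<and> h (j, k) < h (i, k)"
proof -
  \<comment> \<open>\<open>C\<close> lists only the interior vertices. Only these have to lie in
    \<open>V\<close>, which bounds the length by \<open>card V\<close>.\<close>
  define chain where "chain i k C \<longleftrightarrow>
    sorted_wrt (\<lambda>p q. (p, q) \<in> \<Delta>) (i # C @ [k]) \<and> set C \<subseteq> V" for i k C
  define L where "L i k = length ` {C. chain i k C}" for i k
  define h where "h \<alpha> = Max (L (fst \<alpha>) (snd \<alpha>))" for \<alpha>
  have bound: "length C \<le> card V" if "chain i k C" for i k C
  proof -
    have "sorted_wrt (\<lambda>p q. (p, q) \<in> \<Delta>) C"
      using that by (simp add: chain_def sorted_wrt_append)
    then have "distinct C"
      using A1 by (intro sorted_wrt_distinct) (auto simp: irreflp_on_def)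
    then show ?thesis
      using that fin card_mono[of V "set C"] unfolding chain_def
      by (simp add: distinct_card)
  qed
  have L_fin: "finite (L i k)" for i k
  proof (rule finite_subset)
    show "L i k \<subseteq> {..card V}"
      unfolding L_def using bound by blast
  qed simp
  have less: "h \<alpha> < h \<beta>"
    if "(fst \<alpha>, snd \<alpha>) \<in> \<Delta>"
      and step: "\<And>C. chain (fst \<alpha>) (snd \<alpha>) C \<Longrightarrow> \<exists>D. chain (fst \<beta>) (snd \<beta>) D \<and> length D = Suc (length C)"
    for \<alpha> \<beta>
  proof -
    \<comment> \<open>The empty interior makes the set of lengths nonempty, so its maximum is
      attained by some chain, and that chain can be lengthened.\<close>
    have "chain (fst \<alpha>) (snd \<alpha>) []"
      using that by (simp add: chain_def)
    then have "h \<alpha> \<in> L (fst \<alpha>) (snd \<alpha>)"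
      unfolding h_def using L_fin by (intro Max_in) (auto simp: L_def)
    then obtain C where "chain (fst \<alpha>) (snd \<alpha>) C" "h \<alpha> = length C"
      by (auto simp: L_def)
    then obtain D where "chain (fst \<beta>) (snd \<beta>) D" "length D = Suc (h \<alpha>)"
      using step by metis
    then have "Suc (h \<alpha>) \<in> L (fst \<beta>) (snd \<beta>)"
      by (force simp: L_def)
    then show ?thesis
      using Max_ge[OF L_fin, of "Suc (h \<alpha>)"] unfolding h_def[of \<beta>] by (simp add: Suc_le_eq)
  qed
  show thesis
  proof (rule that)
    fix i j k
    assume ij: "(i, j) \<in> \<Delta> \<inter> V \<times> V" and jk: "(j, k) \<in> \<Delta> \<inter> V \<times> V" and ik: "(i, k) \<in> \<Delta>"
    have "chain i k (C @ [j])" if "chain i j C" for C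
    proof -
      \<comment> \<open>Appending \<open>j\<close> to the interior creates the new pairs (p, k).
        (A2) on the path i, p, j, k turns (i, j) \<in> \<Delta> into (p, k) \<in> \<Delta>.\<close>
      have "(p, k) \<in> \<Delta>" if "p \<in> set C" for p
        using A2[of i p j k] \<open>chain i j C\<close> that ij jk ik
        by (auto simp: chain_def sorted_wrt_append)
      then show ?thesis
        using that ij jk ik by (auto simp: chain_def sorted_wrt_append)
    qed
    then have "h (i, j) < h (i, k)"
      using ij by (intro less) (auto intro!: exI[of _ "_ @ [j]"])
    moreover have "chain i k (j # C)" if "chain j k C" for C
    proof -
      \<comment> \<open>Dually, (A2) on the path i, j, p, k turns (j, k) \<in> \<Delta> into (i, p)
        \<in> \<Delta>.\<close>
      have "(i, p) \<in> \<Delta>" if "p \<in> set C" for p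
        using A2[of i j p k] \<open>chain j k C\<close> that ij jk ik
        by (auto simp: chain_def sorted_wrt_append)
      then show ?thesis
        using that ij jk ik by (auto simp: chain_def sorted_wrt_append)
    qed
    then have "h (j, k) < h (i, k)"
      using jk by (intro less) (auto intro!: exI[of _ "j # _"])
    ultimately show "h (i, j) < h (i, k) \<and> h (j, k) < h (i, k)" ..
  qed
qed

section \<open>Coefficients of ordered products\<close>

text \<open>Only the basis vector of \<open>y\<close> at \<open>(snd \<alpha>, k)\<close> can
  contribute at \<open>(i, k)\<close>, so the double sum has at most one nonzero term. The case
  \<open>a = 0\<close> is separate because \<open>single \<alpha> 0\<close> has no keys.\<close>

lemma lookup_free_mult_single:
  "Poly_Mapping.lookup (free_mult \<Delta> (Poly_Mapping.single \<alpha> a) y) (i, k) =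
    (if fst \<alpha> = i \<and> (i, k) \<in> \<Delta> then a * Poly_Mapping.lookup y (snd \<alpha>, k) else 0)"
proof (cases "a = 0")
  case False
  have "Poly_Mapping.lookup (free_mult \<Delta> (Poly_Mapping.single \<alpha> a) y) (i, k) =
    (\<Sum>\<beta>\<in>Poly_Mapping.keys y. if \<beta> = (snd \<alpha>, k) then
       (if fst \<alpha> = i \<and> (i, k) \<in> \<Delta> then a * Poly_Mapping.lookup y \<beta> else 0) else 0)"
    using False
    by (auto simp: free_mult_def basis_mult_def lookup_sum lookup_single when_def prod_eq_iff
        simp del: sum.delta intro!: sum.cong)
  also have "\<dots> = (if fst \<alpha> = i \<and> (i, k) \<in> \<Delta> then a * Poly_Mapping.lookup y (snd \<alpha>, k) else 0)"
    by (simp add: sum.delta in_keys_iff)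
  finally show ?thesis .
qed (simp add: free_mult_def)

lemma root_elt_eq: "root_elt \<Delta> \<alpha> a = (1, Poly_Mapping.single \<alpha> a)"
  by (simp add: root_elt_def adj_ring_def)

lemma G_eq: "G \<Delta> = {1} \<times> free_mod \<Delta>"
  by (auto simp: G_def adj_ring_def)

text \<open>Only the component in R\<Delta> is kept, since the scalar component of such a product is
  always 1. The coefficients form a plain function, to be changed rank by rank; only its values on
  the list enter.\<close>

definition root_prod ::
    "('i \<times> 'i) set \<Rightarrow> ('i \<times> 'i \<Rightarrow> 'a::ring_1) \<Rightarrow> ('i \<times> 'i) list \<Rightarrow> ('i, 'a) fmod"
  where "root_prod \<Delta> a \<alpha>s = snd (list_prod \<Delta> (map (\<lambda>\<alpha>. root_elt \<Delta> \<alpha> (a \<alpha>)) \<alpha>s))"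

lemma root_prod_Nil [simp]: "root_prod \<Delta> a [] = 0"
  by (simp add: root_prod_def list_prod_def adj_ring_def)

lemma map_times_one:
  "Poly_Mapping.map ((*) 1) y = (y :: 'b \<Rightarrow>\<^sub>0 'a::ring_1)"
  "Poly_Mapping.map (\<lambda>c. c * 1) y = (y :: 'b \<Rightarrow>\<^sub>0 'a::ring_1)"
  by (auto intro!: poly_mapping_eqI simp: map.rep_eq when_def)

lemma list_prod_root_elts:
  "list_prod \<Delta> (map (\<lambda>\<alpha>. root_elt \<Delta> \<alpha> (a \<alpha>)) \<alpha>s) = (1, root_prod \<Delta> a \<alpha>s)"
proof -
  have "fst (list_prod \<Delta> (map (\<lambda>\<alpha>. root_elt \<Delta> \<alpha> (a \<alpha>)) \<alpha>s)) = 1"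
    by (induction \<alpha>s) (auto simp: list_prod_def adj_ring_def root_elt_eq split: prod.splits)
  then show ?thesis
    by (simp add: root_prod_def prod_eq_iff)
qed

text \<open>This is (1 + u)(1 + y) = 1 + y + u + uy, with 1 + u the factor of the head and 1 + y the
  product over the tail.\<close>

lemma root_prod_Cons:
  "root_prod \<Delta> a (\<alpha> # \<alpha>s) =
    root_prod \<Delta> a \<alpha>s + Poly_Mapping.single \<alpha> (a \<alpha>) +
    free_mult \<Delta> (Poly_Mapping.single \<alpha> (a \<alpha>)) (root_prod \<Delta> a \<alpha>s)"
proof -
  have "(1, root_prod \<Delta> a (\<alpha> # \<alpha>s)) =
    (1, Poly_Mapping.single \<alpha> (a \<alpha>)) \<otimes>\<^bsub>adj_ring \<Delta>\<^esub> (1, root_prod \<Delta> a \<alpha>s)"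
    unfolding list_prod_root_elts[symmetric] by (simp add: list_prod_def root_elt_eq)
  then show ?thesis
    by (simp add: adj_ring_def map_times_one)
qed

lemma lookup_root_prod_Cons:
  "Poly_Mapping.lookup (root_prod \<Delta> a (\<alpha> # \<alpha>s)) (i, k) =
    Poly_Mapping.lookup (root_prod \<Delta> a \<alpha>s) (i, k) + (if \<alpha> = (i, k) then a \<alpha> else 0) +
    (if fst \<alpha> = i \<and> (i, k) \<in> \<Delta> then a \<alpha> * Poly_Mapping.lookup (root_prod \<Delta> a \<alpha>s) (snd \<alpha>, k) else 0)"
  by (simp add: root_prod_Cons lookup_add lookup_single lookup_free_mult_single when_def)

text \<open>A nonzero product of basis vectors inherits its first and last vertex from its factors
  and has its index in \<Delta>, so the span of \<Delta> \<inter> V \<times> V is closed under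
  multiplication.\<close>

lemma keys_root_prod:
  assumes "set \<alpha>s \<subseteq> \<Delta> \<inter> V \<times> V"
  shows "Poly_Mapping.keys (root_prod \<Delta> a \<alpha>s) \<subseteq> \<Delta> \<inter> V \<times> V"
  using assms
proof (induction \<alpha>s)
  case (Cons \<alpha> \<alpha>s)
  have IH: "Poly_Mapping.lookup (root_prod \<Delta> a \<alpha>s) (i, k) = 0" if "(i, k) \<notin> \<Delta> \<inter> V \<times> V" for i k
    using Cons that by (metis in_keys_iff set_subset_Cons subset_iff)
  have "Poly_Mapping.lookup (root_prod \<Delta> a (\<alpha> # \<alpha>s)) (i, k) = 0"
    if "(i, k) \<notin> \<Delta> \<inter> V \<times> V" for i k
    using that IH[OF that] IH[of "snd \<alpha>" k] Cons.prems
    by (auto simp: lookup_root_prod_Cons)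
  then show ?case by (auto simp: in_keys_iff)
qed simp

text \<open>A factor with coefficient 0 is 1. This allows passing between the support of a family
  and any longer sorted list.\<close>

lemma root_prod_filter_nonzero:
  "root_prod \<Delta> a (filter (\<lambda>\<alpha>. a \<alpha> \<noteq> 0) \<alpha>s) = root_prod \<Delta> a \<alpha>s"
  by (induction \<alpha>s) (auto simp: root_prod_Cons free_mult_def)

section \<open>The triangular system and its solution\<close>

text \<open>Triangularity is phrased as a comparison of two families that agree below the rank of
  \<beta>, which avoids an explicit formula and serves existence and uniqueness alike. The test
  \<open>\<beta> \<in> set \<alpha>s\<close> is there because the induction passes through tails
  that may lack \<beta>.\<close>

lemma root_prod_triangular:
  fixes h :: "'i \<times> 'i \<Rightarrow> nat"
  assumes h: "\<And>i j k. (i, j) \<in> \<Delta> \<inter> V \<times> V \<Longrightarrow> (j, k) \<in> \<Delta> \<inter> V \<times> V \<Longrightarrow> (i, k) \<in> \<Delta> \<Longrightarrow>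
       h (i, j) < h (i, k) \<and> h (j, k) < h (i, k)"
    and "set \<alpha>s \<subseteq> \<Delta> \<inter> V \<times> V" "distinct \<alpha>s"
    and "\<And>\<gamma>. \<gamma> \<in> \<Delta> \<inter> V \<times> V \<Longrightarrow> h \<gamma> < h \<beta> \<Longrightarrow> a \<gamma> = b \<gamma>"
  shows "Poly_Mapping.lookup (root_prod \<Delta> a \<alpha>s) \<beta> - (if \<beta> \<in> set \<alpha>s then a \<beta> else 0) =
         Poly_Mapping.lookup (root_prod \<Delta> b \<alpha>s) \<beta> - (if \<beta> \<in> set \<alpha>s then b \<beta> else 0)"
  using assms(2-)
proof (induction \<alpha>s arbitrary: \<beta>)
  case (Cons \<alpha> \<alpha>s)
  obtain i k where \<beta>: "\<beta> = (i, k)" by (cases \<beta>)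
  let ?y = "\<lambda>a. Poly_Mapping.lookup (root_prod \<Delta> a \<alpha>s)"
  have IH: "?y a \<beta> - (if \<beta> \<in> set \<alpha>s then a \<beta> else 0) = ?y b \<beta> - (if \<beta> \<in> set \<alpha>s then b \<beta> else 0)"
    using Cons.prems by (intro Cons.IH) auto
  \<comment> \<open>If \<open>(snd \<alpha>, k)\<close> is in the finite set, it and \<alpha> have
    smaller rank than \<beta>. Otherwise both tail coefficients vanish.\<close>
  have prod: "a \<alpha> * ?y a (snd \<alpha>, k) = b \<alpha> * ?y b (snd \<alpha>, k)" if "fst \<alpha> = i" "(i, k) \<in> \<Delta>"
  proof (cases "(snd \<alpha>, k) \<in> \<Delta> \<inter> V \<times> V")
    case True
    have \<alpha>: "(i, snd \<alpha>) \<in> \<Delta> \<inter> V \<times> V"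
      using Cons.prems(1) that by auto
    note less = h[OF \<alpha> True that(2)]
    have "a \<alpha> = b \<alpha>"
      using Cons.prems(1,3) less \<beta> that(1) by auto
    moreover have "a (snd \<alpha>, k) = b (snd \<alpha>, k)"
      using Cons.prems(3) less \<beta> True by auto
    \<comment> \<open>The induction hypothesis is applied at the lower root; the diagonal terms
      subtracted there agree as well.\<close>
    then have "?y a (snd \<alpha>, k) = ?y b (snd \<alpha>, k)"
      using Cons.IH[of "(snd \<alpha>, k)"] Cons.prems less \<beta> by (auto split: if_splits)
    ultimately show ?thesis by simp
  next
    case False
    moreover have "set \<alpha>s \<subseteq> \<Delta> \<inter> V \<times> V"
      using Cons.prems(1) by simp
    ultimately have "(snd \<alpha>, k) \<notin> Poly_Mapping.keys (root_prod \<Delta> a \<alpha>s)"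
      "(snd \<alpha>, k) \<notin> Poly_Mapping.keys (root_prod \<Delta> b \<alpha>s)"
      using keys_root_prod by blast+
    then show ?thesis by (simp add: in_keys_iff)
  qed
  \<comment> \<open>If \<alpha> = \<beta>, distinctness keeps \<beta> out of the tail, so its
    diagonal term is counted once.\<close>
  show ?case
    using IH prod Cons.prems(2) unfolding \<beta> lookup_root_prod_Cons
    by (auto simp: algebra_simps split: if_splits)
qed simp

text \<open>The system is solved by increasing rank. Once all coefficients of rank below
  \<open>n\<close> are right, the values at rank \<open>n\<close> are corrected, which leaves the
  lower coefficients unchanged.\<close>

lemma root_prod_surj:
  assumes fin: "finite V"
    and A1: "\<And>i. (i, i) \<notin> \<Delta>"
    and A2: "\<And>i j k l. (i, j) \<in> \<Delta> \<Longrightarrow> (j, k) \<in> \<Delta> \<Longrightarrow> (k, l) \<in> \<Delta> \<Longrightarrow> (i, l) \<in> \<Delta> \<Longrightarrow>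
               ((i, k) \<in> \<Delta> \<longleftrightarrow> (j, l) \<in> \<Delta>)"
    and \<alpha>s: "set \<alpha>s = \<Delta> \<inter> V \<times> V" "distinct \<alpha>s"
    and x: "Poly_Mapping.keys x \<subseteq> \<Delta> \<inter> V \<times> V"
  obtains a where "root_prod \<Delta> a \<alpha>s = x"
proof -
  obtain h :: "'a \<times> 'a \<Rightarrow> nat" where h: "\<And>i j k. (i, j) \<in> \<Delta> \<inter> V \<times> V \<Longrightarrow>
      (j, k) \<in> \<Delta> \<inter> V \<times> V \<Longrightarrow> (i, k) \<in> \<Delta> \<Longrightarrow> h (i, j) < h (i, k) \<and> h (j, k) < h (i, k)"
    using ordered_pairs_rank[OF fin A1 A2] by blast
  have "\<exists>a. \<forall>\<beta>\<in>\<Delta> \<inter> V \<times> V. h \<beta> < n \<longrightarrow>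
      Poly_Mapping.lookup (root_prod \<Delta> a \<alpha>s) \<beta> = Poly_Mapping.lookup x \<beta>" for n
  proof (induction n)
    case (Suc n)
    then obtain a where a: "\<And>\<beta>. \<beta> \<in> \<Delta> \<inter> V \<times> V \<Longrightarrow> h \<beta> < n \<Longrightarrow>
        Poly_Mapping.lookup (root_prod \<Delta> a \<alpha>s) \<beta> = Poly_Mapping.lookup x \<beta>"
      by blast
    \<comment> \<open>The correction at rank \<open>n\<close> is the defect of the current product.
      By triangularity the coefficient there moves by exactly this amount.\<close>
    define b where "b \<beta> = (if h \<beta> = n
      then a \<beta> + Poly_Mapping.lookup x \<beta> - Poly_Mapping.lookup (root_prod \<Delta> a \<alpha>s) \<beta> else a \<beta>)" for \<beta>
    have "Poly_Mapping.lookup (root_prod \<Delta> b \<alpha>s) \<beta> = Poly_Mapping.lookup x \<beta>"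
      if "\<beta> \<in> \<Delta> \<inter> V \<times> V" "h \<beta> < Suc n" for \<beta>
    proof -
      have "Poly_Mapping.lookup (root_prod \<Delta> b \<alpha>s) \<beta> - b \<beta> =
          Poly_Mapping.lookup (root_prod \<Delta> a \<alpha>s) \<beta> - a \<beta>"
        using root_prod_triangular[where \<Delta> = \<Delta> and V = V and h = h, OF h, of \<alpha>s \<beta> b a] that \<alpha>s by (auto simp: b_def)
      then show ?thesis
        using a[OF that(1)] that(2) by (auto simp: b_def algebra_simps split: if_splits)
    qed
    then show ?case by blast
  qed simp
  \<comment> \<open>Finitely many roots have bounded rank, so some \<open>n\<close> exceeds every
    rank.\<close>
  moreover have "\<beta> \<in> \<Delta> \<inter> V \<times> V \<Longrightarrow> h \<beta> < Suc (Max (h ` (\<Delta> \<inter> V \<times> V)))" for \<beta>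
    using fin by (auto simp: less_Suc_eq_le)
  ultimately obtain a where a: "\<And>\<beta>. \<beta> \<in> \<Delta> \<inter> V \<times> V \<Longrightarrow>
      Poly_Mapping.lookup (root_prod \<Delta> a \<alpha>s) \<beta> = Poly_Mapping.lookup x \<beta>"
    by blast
  have "root_prod \<Delta> a \<alpha>s = x"
  proof (rule poly_mapping_eqI)
    fix \<beta>
    show "Poly_Mapping.lookup (root_prod \<Delta> a \<alpha>s) \<beta> = Poly_Mapping.lookup x \<beta>"
    proof (cases "\<beta> \<in> \<Delta> \<inter> V \<times> V")
      case False
      then have "\<beta> \<notin> Poly_Mapping.keys (root_prod \<Delta> a \<alpha>s)" "\<beta> \<notin> Poly_Mapping.keys x"
        using x keys_root_prod[of \<alpha>s \<Delta> V a] \<alpha>s(1) by auto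
      then show ?thesis by (simp add: in_keys_iff)
    qed (rule a)
  qed
  then show thesis by (rule that)
qed

text \<open>Induction on the rank: when the families agree at all smaller ranks, equal products
  leave equal diagonal terms.\<close>

lemma root_prod_inj:
  assumes fin: "finite V"
    and A1: "\<And>i. (i, i) \<notin> \<Delta>"
    and A2: "\<And>i j k l. (i, j) \<in> \<Delta> \<Longrightarrow> (j, k) \<in> \<Delta> \<Longrightarrow> (k, l) \<in> \<Delta> \<Longrightarrow> (i, l) \<in> \<Delta> \<Longrightarrow>
               ((i, k) \<in> \<Delta> \<longleftrightarrow> (j, l) \<in> \<Delta>)"
    and \<alpha>s: "set \<alpha>s = \<Delta> \<inter> V \<times> V" "distinct \<alpha>s"
    and eq: "root_prod \<Delta> a \<alpha>s = root_prod \<Delta> b \<alpha>s"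
    and \<beta>: "\<beta> \<in> \<Delta> \<inter> V \<times> V"
  shows "a \<beta> = b \<beta>"
proof -
  obtain h :: "'a \<times> 'a \<Rightarrow> nat" where h: "\<And>i j k. (i, j) \<in> \<Delta> \<inter> V \<times> V \<Longrightarrow>
      (j, k) \<in> \<Delta> \<inter> V \<times> V \<Longrightarrow> (i, k) \<in> \<Delta> \<Longrightarrow> h (i, j) < h (i, k) \<and> h (j, k) < h (i, k)"
    using ordered_pairs_rank[OF fin A1 A2] by blast
  show ?thesis
    using \<beta>
  proof (induction "h \<beta>" arbitrary: \<beta> rule: less_induct)
    case less
    then show ?case
      using root_prod_triangular[where \<Delta> = \<Delta> and V = V and h = h, OF h, of \<alpha>s \<beta> a b] \<alpha>s eq by auto
  qed
qed

section \<open>From finite vertex sets to arbitrary \<Delta>\<close>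

theorem theorem5p3:
  fixes \<Lambda> :: "'i set"
    and \<Delta> :: "('i \<times> 'i) set"
    and prec :: "'i \<times> 'i \<Rightarrow> 'i \<times> 'i \<Rightarrow> bool" (infix "\<prec>" 50)
  assumes "\<Delta> \<subseteq> \<Lambda> \<times> \<Lambda>"
    and A1: "\<forall>i\<in>\<Lambda>. (i, i) \<notin> \<Delta>"
    and A2: "\<forall>i j k l. (i, j) \<in> \<Delta> \<longrightarrow> (j, k) \<in> \<Delta> \<longrightarrow> (k, l) \<in> \<Delta> \<longrightarrow> (i, l) \<in> \<Delta> \<longrightarrow>
               ((i, k) \<in> \<Delta> \<longleftrightarrow> (j, l) \<in> \<Delta>)"
    and "irreflp_on \<Delta> (\<prec>)" and "transp_on \<Delta> (\<prec>)" and "totalp_on \<Delta> (\<prec>)"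
  shows "(G \<Delta> :: ('a::ring_1 \<times> ('i, 'a) fmod) set) = ordered_product \<Delta> (\<prec>) \<and>
    (\<forall>g \<in> (G \<Delta> :: ('a \<times> ('i, 'a) fmod) set).
       \<exists>!a :: ('i \<times> 'i) \<Rightarrow>\<^sub>0 'a. Poly_Mapping.keys a \<subseteq> \<Delta> \<and>
         (\<exists>\<alpha>s. sorted_wrt (\<prec>) \<alpha>s \<and> set \<alpha>s = Poly_Mapping.keys a \<and>
            g = list_prod \<Delta> (map (\<lambda>\<alpha>. root_elt \<Delta> \<alpha> (Poly_Mapping.lookup a \<alpha>)) \<alpha>s)))"
proof -
  have A1': "(i, i) \<notin> \<Delta>" for i
    using assms(1) A1 by auto
  have A2': "(i, k) \<in> \<Delta> \<longleftrightarrow> (j, l) \<in> \<Delta>"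
    if "(i, j) \<in> \<Delta>" "(j, k) \<in> \<Delta>" "(k, l) \<in> \<Delta>" "(i, l) \<in> \<Delta>" for i j k l
    using A2 that by blast
  have irrefl: "irreflp_on S (\<prec>)" and trans: "transp_on S (\<prec>)" and total: "totalp_on S (\<prec>)"
    if "S \<subseteq> \<Delta>" for S
    using that assms(4-6) by (auto intro: irreflp_on_subset transp_on_subset totalp_on_subset)
  \<comment> \<open>A finite \<open>V\<close> containing the vertices of the given supports reduces
    the problem to the finite set \<open>E V\<close>. The support alone would not do: solving for an
    element can require coefficients at further roots of \<open>E V\<close>.\<close>
  define E where "E V = \<Delta> \<inter> V \<times> V" for V
  have enum: "\<exists>\<alpha>s. sorted_wrt (\<prec>) \<alpha>s \<and> set \<alpha>s = E V \<and> distinct \<alpha>s" if "finite V" for V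
    using sorted_wrt_list_exists[of "E V" "(\<prec>)"] trans[of "E V"] total[of "E V"] irrefl[of "E V"]
      sorted_wrt_distinct that
    by (metis E_def Int_lower1 finite_Int finite_SigmaI)
  have keys_in_E: "Poly_Mapping.keys x \<subseteq> E V"
    if "Poly_Mapping.keys x \<subseteq> \<Delta>" "fst ` Poly_Mapping.keys x \<union> snd ` Poly_Mapping.keys x \<subseteq> V"
    for x :: "('i, 'a) fmod" and V
    using that by (fastforce simp: E_def mem_Times_iff)
  have pad: "root_prod \<Delta> (Poly_Mapping.lookup a) \<beta>s = root_prod \<Delta> (Poly_Mapping.lookup a) \<alpha>s"
    if "sorted_wrt (\<prec>) \<alpha>s" "set \<alpha>s = E V" "sorted_wrt (\<prec>) \<beta>s" "set \<beta>s = Poly_Mapping.keys a"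
      "Poly_Mapping.keys a \<subseteq> E V"
    for a :: "('i, 'a) fmod" and V \<alpha>s \<beta>s
  proof -
    \<comment> \<open>Both sides enumerate the support of \<open>a\<close> in increasing order, so
      they coincide.\<close>
    have "\<beta>s = filter (\<lambda>\<alpha>. Poly_Mapping.lookup a \<alpha> \<noteq> 0) \<alpha>s"
      using that irrefl[of "set \<beta>s"] trans[of "set \<beta>s"]
      by (intro sorted_wrt_list_unique[of "(\<prec>)"])
        (auto simp: sorted_wrt_filter in_keys_iff E_def)
    then show ?thesis by (simp add: root_prod_filter_nonzero)
  qed
  have expr: "\<exists>a :: ('i, 'a) fmod. Poly_Mapping.keys a \<subseteq> \<Delta> \<and>
      (\<exists>\<alpha>s. sorted_wrt (\<prec>) \<alpha>s \<and> set \<alpha>s = Poly_Mapping.keys a \<and>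
        x = root_prod \<Delta> (Poly_Mapping.lookup a) \<alpha>s)"
    if x: "Poly_Mapping.keys x \<subseteq> \<Delta>" for x :: "('i, 'a) fmod"
  proof -
    define V where "V = fst ` Poly_Mapping.keys x \<union> snd ` Poly_Mapping.keys x"
    have V: "finite V" "Poly_Mapping.keys x \<subseteq> E V"
      using keys_in_E[OF x] by (auto simp: V_def)
    obtain \<alpha>s where \<alpha>s: "sorted_wrt (\<prec>) \<alpha>s" "set \<alpha>s = E V" "distinct \<alpha>s"
      using enum[OF V(1)] by blast
    obtain a where a: "root_prod \<Delta> a \<alpha>s = x"
      using root_prod_surj[OF V(1) A1' A2'] \<alpha>s(2,3) V(2) unfolding E_def by blast
    \<comment> \<open>The solution \<open>a\<close> is arbitrary outside \<open>E V\<close>; cutting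
      it off there gives finite support without changing the product along
      \<open>\<alpha>s\<close>.\<close>
    define b where "b = Poly_Mapping.Abs_poly_mapping (\<lambda>\<alpha>. a \<alpha> when \<alpha> \<in> E V)"
    have "finite {\<alpha>. (a \<alpha> when \<alpha> \<in> E V) \<noteq> 0}"
      by (rule finite_subset[of _ "E V"]) (use V(1) in \<open>auto simp: E_def\<close>)
    then have b: "Poly_Mapping.lookup b = (\<lambda>\<alpha>. a \<alpha> when \<alpha> \<in> E V)"
      by (simp add: b_def Abs_poly_mapping_inverse)
    have keys: "Poly_Mapping.keys b \<subseteq> E V"
      by (auto simp: in_keys_iff b)
    let ?\<beta>s = "filter (\<lambda>\<alpha>. Poly_Mapping.lookup b \<alpha> \<noteq> 0) \<alpha>s"
    have "map (\<lambda>\<alpha>. root_elt \<Delta> \<alpha> (Poly_Mapping.lookup b \<alpha>)) \<alpha>s = map (\<lambda>\<alpha>. root_elt \<Delta> \<alpha> (a \<alpha>)) \<alpha>s"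
      using \<alpha>s(2) by (simp add: b)
    then have "root_prod \<Delta> (Poly_Mapping.lookup b) \<alpha>s = x"
      using a by (simp add: root_prod_def del: map_eq_conv)
    then have "x = root_prod \<Delta> (Poly_Mapping.lookup b) ?\<beta>s"
      by (simp add: root_prod_filter_nonzero)
    moreover have "sorted_wrt (\<prec>) ?\<beta>s" "set ?\<beta>s = Poly_Mapping.keys b"
      using \<alpha>s keys by (auto simp: sorted_wrt_filter in_keys_iff)
    moreover have "Poly_Mapping.keys b \<subseteq> \<Delta>"
      using keys by (auto simp: E_def)
    ultimately show ?thesis by blast
  qed
  have uniq: "a = b"
    if "Poly_Mapping.keys a \<subseteq> \<Delta>" "sorted_wrt (\<prec>) \<beta>s" "set \<beta>s = Poly_Mapping.keys a"
      and "Poly_Mapping.keys b \<subseteq> \<Delta>" "sorted_wrt (\<prec>) \<gamma>s" "set \<gamma>s = Poly_Mapping.keys b"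
      and eq: "root_prod \<Delta> (Poly_Mapping.lookup a) \<beta>s = root_prod \<Delta> (Poly_Mapping.lookup b) \<gamma>s"
    for a b :: "('i, 'a) fmod" and \<beta>s \<gamma>s
  proof (rule poly_mapping_eqI)
    fix \<beta>
    \<comment> \<open>One vertex set for both supports lets the two products be compared along a
      single list.\<close>
    define S where "S = Poly_Mapping.keys a \<union> Poly_Mapping.keys b"
    define V where "V = fst ` S \<union> snd ` S"
    have V: "finite V" "Poly_Mapping.keys a \<subseteq> E V" "Poly_Mapping.keys b \<subseteq> E V"
      using keys_in_E[of a V] keys_in_E[of b V] that(1,4) by (simp_all add: V_def S_def image_Un le_supI1 le_supI2)
    obtain \<alpha>s where \<alpha>s: "sorted_wrt (\<prec>) \<alpha>s" "set \<alpha>s = E V" "distinct \<alpha>s"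
      using enum[OF V(1)] by blast
    have eq': "root_prod \<Delta> (Poly_Mapping.lookup a) \<alpha>s = root_prod \<Delta> (Poly_Mapping.lookup b) \<alpha>s"
      using eq pad[OF \<alpha>s(1,2) that(2,3) V(2)] pad[OF \<alpha>s(1,2) that(5,6) V(3)] by simp
    show "Poly_Mapping.lookup a \<beta> = Poly_Mapping.lookup b \<beta>"
    proof (cases "\<beta> \<in> E V")
      case True
      then show ?thesis
        using root_prod_inj[OF V(1) A1' A2' _ \<alpha>s(3) eq'] \<alpha>s(2) unfolding E_def by blast
    next
      case False
      then have "\<beta> \<notin> Poly_Mapping.keys a" "\<beta> \<notin> Poly_Mapping.keys b"
        using V by auto
      then show ?thesis by (simp add: in_keys_iff)
    qed
  qed
  have "(G \<Delta> :: ('a \<times> ('i, 'a) fmod) set) \<subseteq> ordered_product \<Delta> (\<prec>)"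
  proof
    fix g :: "'a \<times> ('i, 'a) fmod"
    assume "g \<in> G \<Delta>"
    then obtain x where x: "g = (1, x)" "Poly_Mapping.keys x \<subseteq> \<Delta>"
      by (auto simp: G_eq free_mod_def)
    then obtain a \<alpha>s where "Poly_Mapping.keys a \<subseteq> \<Delta>" "sorted_wrt (\<prec>) \<alpha>s"
      "set \<alpha>s = Poly_Mapping.keys a" "x = root_prod \<Delta> (Poly_Mapping.lookup a) \<alpha>s"
      using expr by blast
    then show "g \<in> ordered_product \<Delta> (\<prec>)"
      unfolding ordered_product_def x(1)
      by (auto simp: list_prod_root_elts[symmetric] list_all2_map2 root_subgroup_def
          intro!: exI[of _ \<alpha>s] exI[of _ "map (\<lambda>\<alpha>. root_elt \<Delta> \<alpha> (Poly_Mapping.lookup a \<alpha>)) \<alpha>s"]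
            list_all2_refl)
  qed
  moreover have "g \<in> G \<Delta>" if "g \<in> ordered_product \<Delta> (\<prec>)" for g :: "'a \<times> ('i, 'a) fmod"
  proof -
    obtain \<alpha>s gs where gs: "g = list_prod \<Delta> gs" "set \<alpha>s \<subseteq> \<Delta>" "sorted_wrt (\<prec>) \<alpha>s"
      "list_all2 (\<lambda>\<alpha> g. g \<in> root_subgroup \<Delta> \<alpha>) \<alpha>s gs"
      using \<open>g \<in> ordered_product \<Delta> (\<prec>)\<close> unfolding ordered_product_def by blast
    \<comment> \<open>Distinct roots allow the coefficients of the factors to be collected into one
      function: the update at the head does not disturb the tail.\<close>
    have "distinct \<alpha>s"
      using gs(2,3) irrefl sorted_wrt_distinct by blast
    with gs(4) have "\<exists>a. gs = map (\<lambda>\<alpha>. root_elt \<Delta> \<alpha> (a \<alpha>)) \<alpha>s"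
    proof (induction rule: list_all2_induct)
      case (Cons \<alpha> \<alpha>s g gs)
      then obtain a c where "gs = map (\<lambda>\<alpha>. root_elt \<Delta> \<alpha> (a \<alpha>)) \<alpha>s" "g = root_elt \<Delta> \<alpha> c"
        by (auto simp: root_subgroup_def)
      with Cons.prems show ?case
        by (auto intro!: exI[of _ "a(\<alpha> := c)"])
    qed simp
    then obtain a where "g = (1, root_prod \<Delta> a \<alpha>s)"
      using gs(1) list_prod_root_elts by blast
    \<comment> \<open>With \<open>V = UNIV\<close> the bound on the support is just membership in
      R\<Delta>.\<close>
    then show ?thesis
      using keys_root_prod[of \<alpha>s \<Delta> UNIV a] gs(2) by (auto simp: G_eq free_mod_def)
  qed
  moreover have "\<exists>!a :: ('i, 'a) fmod. Poly_Mapping.keys a \<subseteq> \<Delta> \<and>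
      (\<exists>\<alpha>s. sorted_wrt (\<prec>) \<alpha>s \<and> set \<alpha>s = Poly_Mapping.keys a \<and>
        g = list_prod \<Delta> (map (\<lambda>\<alpha>. root_elt \<Delta> \<alpha> (Poly_Mapping.lookup a \<alpha>)) \<alpha>s))"
    if "g \<in> G \<Delta>" for g :: "'a \<times> ('i, 'a) fmod"
  proof -
    obtain x where x: "g = (1, x)" "Poly_Mapping.keys x \<subseteq> \<Delta>"
      using \<open>g \<in> G \<Delta>\<close> by (auto simp: G_eq free_mod_def)
    show ?thesis
      unfolding x(1) list_prod_root_elts prod.inject
    proof (rule ex_ex1I, goal_cases)
      case 1
      then show ?case using expr[OF x(2)] by simp
    next
      case (2 a b)
      then show ?case by (elim conjE exE) (rule uniq, simp_all)
    qed
  qed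
  ultimately show ?thesis by blast
qed

end
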